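(* Let $\mathcal{S}$ be an FSA with observer $\mathcal{S}_{obs}$, detector $\mathcal{S}_{det}$, and $\varepsilon$-extended self-composition $\mathrm{CC_A^{\leftarrow_\epsilon}}(\mathcal{S})$. Let $x_1,x_2,x_3,x_4\in X$ be states with $x_1\neq x_2$ and $x_3\neq x_4$. The following hold. (i) For every transition $\{x_1,x_2\}\xrightarrow{\sigma}\{x_3,x_4\}$ in $\mathcal{S}_{det}$, there is an observable transition sequence $(x_1,x_2)\xrightarrow{s'}(x_3,x_4)$ or $(x_1,x_2)\xrightarrow{s'}(x_4,x_3)$ in $\mathrm{CC_A^{\leftarrow_\epsilon}}(\mathcal{S})$ such that $\ell(s')=\sigma$. (ii) For every transition $\{x_1,x_2\}\xrightarrow{\sigma}\{x_3\}$ in $\mathcal{S}_{det}$, there is an observable transition sequence $(x_1,x_2)\xrightarrow{s'}(x_3,x_3)$ in $\mathrm{CC_A^{\leftarrow_\epsilon}}(\mathcal{S})$ such that $\ell(s')=\sigma$. (iii) For every transition $\{x_1\}\xrightarrow{\sigma}\{x_3,x_4\}$ in $\mathcal{S}_{det}$, there is an observable transition sequence $(x_1,x_1)\xrightarrow{s'}(x_3,x_4)$ in $\mathrm{CC_A^{\leftarrow_\epsilon}}(\mathcal{S})$ such that $\ell(s')=\sigma$. (iv) For every transition $\{x_1\}\xrightarrow{\sigma}\{x_3\}$ in $\mathcal{S}_{det}$, there is an observable transition sequence $(x_1,x_1)\xrightarrow{s'}(x_3,x_3)$ in $\mathrm{CC_A^{\leftarrow_\epsilon}}(\mathcal{S})$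 such that $\ell(s')=\sigma$. (v) Consider an arbitrary transition sequence $x_0'\xrightarrow{s_0'}x_1'\xrightarrow{t_1'}x_2'\xrightarrow{s_1'}\cdots\xrightarrow{t_n'}x_{2n}'\xrightarrow{s_n'}x_{2n+1}'$ in $\mathrm{CC_A^{\leftarrow_\epsilon}}(\mathcal{S})$, where $x_0'\in X_0'$, $x_1',\dots,x_{2n+1}'\in X'$, $s_0',\dots,s_n'\in(T_{uo}'\cup\{\varepsilon\})^*$, $t_1',\dots,t_n'\in T_o'$. For every $i\in\{0,1,\dots,n\}$, denote by $q_i$ the union of all states of the unobservable transition sequence $x_{2i}'\xrightarrow{s_i'}x_{2i+1}'$ (i.e., the set of all $x\in X$ occurring as a left or right component of a state visited along it), so that one obtains a sequence $q_0\xrightarrow{\ell(t_1')}\cdots\xrightarrow{\ell(t_n')}q_n$. Then for every $i\in\{1,\dots,n\}$ there exists $\bar q_i\supset q_i$ such that $\mathcal{M}(\mathcal{S},\epsilon)\xrightarrow{\ell(t_1')}\bar q_1\xrightarrow{\ell(t_2')}\cdots\xrightarrow{\ell(t_n')}\bar q_n$ is a transition sequence of $\mathcal{S}_{obs}$.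
   Context: The symbol $\subset$ denotes the (not necessarily proper) subset relation. For a finite alphabet $A$, $A^*$ denotes the set of finite words over $A$, including the empty word $\epsilon$. $|S|$ is the cardinality of a set $S$, and $2^S$ its power set. A finite-state automaton (FSA) is a sextuple $\mathcal{S}=(X,T,X_0,\delta,\Sigma,\ell)$, where $X$ is a finite set of states, $T$ a finite set of events, $X_0\subset X$ a set of initial states, $\delta\subset X\times T\times X$ a transition relation, $\Sigma$ a finite set of outputs (labels), and $\ell:T\to\Sigma\cup\{\epsilon\}$ a labeling function, extended to $\ell:T^*\to\Sigma^*$ by $\ell(t_1t_2\dots)=\ell(t_1)\ell(t_2)\dots$, $\ell(\epsilon)=\epsilon$. $T_o=\{t\in T:\ell(t)\in\Sigma\}$ and $T_{uo}=\{t\in T:\ell(t)=\epsilon\}$ are the sets of observable and unobservable events. $\delta$ is extended to $\delta\subset X\times T^*\times X$ in the usual way; $x\xrightarrow{s}x'$ means $(x,s,x')\in\delta$. For $\sigma\in\Sigma^*$, the current-state estimate is $\mathcal{M}(\mathcal{S},\sigma)=\{x\in X : \exists x_0\in X_0,\ \exists s\in T^*,\ \ell(s)=\sigma \text{ and } x_0\xrightarrow{s}x\}$. For $x\in X$, the unobservable reach is $\mathrm{UR}(x)=\{x'\in X:\exists s\in(T_{uo})^*,\ (x,s,x')\in\delta\}$, and for $\sigma\in\Sigma$ the observable reach is $\mathrm{Reach}_\sigma(x)=\{x'\in X:\exists t\in T,\ (x,t,x')\in\delta,\ \ell(t)=\sigma\}$. For $X'\subset X$, $\mathrm{UR}(X')=\bigcup_{x\in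 X'}\mathrm{UR}(x)$ and $\mathrm{Reach}_\sigma(X')=\bigcup_{x\in X'}\mathrm{Reach}_\sigma(x)$. Observer: $\mathcal{S}_{obs}=(2^X\setminus\{\emptyset\},\Sigma,\mathcal{M}(\mathcal{S},\epsilon),\delta_{obs})$ is the deterministic FSA with unique initial state $\mathcal{M}(\mathcal{S},\epsilon)$ such that for all $X'\in 2^X$ and $\sigma\in\Sigma^*$, $\delta_{obs}(\mathcal{M}(\mathcal{S},\epsilon),\sigma)=X'$ if and only if $X'=\mathcal{M}(\mathcal{S},\sigma)$. (For a deterministic automaton, $\delta_{obs}(q,\sigma)$ denotes the unique state, if any, reached from $q$ via $\sigma$.) Detector: $\mathcal{S}_{det}=(Q,\Sigma,\mathcal{M}(\mathcal{S},\epsilon),\delta_{det})$ is the nondeterministic FSA with initial state $\mathcal{M}(\mathcal{S},\epsilon)$, where $Q\subset 2^X\setminus\{\emptyset\}$ consists of $\mathcal{M}(\mathcal{S},\epsilon)$ and the subsets of $X$ of cardinality $\le 2$; for all $q,q'\in Q$ and $\sigma\in\Sigma$, $(q,\sigma,q')\in\delta_{det}$ if and only if either (1) $|\mathrm{UR}(\mathrm{Reach}_\sigma(q))|>1$, $q'\subset\mathrm{UR}(\mathrm{Reach}_\sigma(q))$, and $|q'|=2$, or (2) $|\mathrm{UR}(\mathrm{Reach}_\sigma(q))|=1$ and $q'=\mathrm{UR}(\mathrm{Reach}_\sigma(q))$. Self-composition: $\mathrm{CC_A}(\mathcal{S})=(X',T',X_0',\delta')$, where $X'=X\times X$, $X_0'=X_0\times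 X_0$, $T'=T_o'\cup T_{uo}'$ with $T_o'=\{(t,t'):t,t'\in T,\ \ell(t)=\ell(t')\in\Sigma\}$ and $T_{uo}'=\{(t,\epsilon):t\in T,\ \ell(t)=\epsilon\}\cup\{(\epsilon,t):t\in T,\ \ell(t)=\epsilon\}$; for $(y_1,y_1'),(y_2,y_2')\in X'$: $((y_1,y_1'),(t,t'),(y_2,y_2'))\in\delta'$ iff $(y_1,t,y_2),(y_1',t',y_2')\in\delta$, for $(t,t')\in T_o'$; $((y_1,y_1'),(t,\epsilon),(y_2,y_2'))\in\delta'$ iff $(y_1,t,y_2)\in\delta$ and $y_1'=y_2'$, for $(t,\epsilon)\in T_{uo}'$; $((y_1,y_1'),(\epsilon,t),(y_2,y_2'))\in\delta'$ iff $y_1=y_2$ and $(y_1',t,y_2')\in\delta$, for $(\epsilon,t)\in T_{uo}'$. The label $\ell(t')$ of $t'\in T'$ is the common label in $\Sigma\cup\{\epsilon\}$ of its two components, and $\ell$ extends to sequences by concatenation. $\varepsilon$-extended self-composition: $\mathrm{CC_A^{\leftarrow_\epsilon}}(\mathcal{S})=(X',T'\cup\{\varepsilon\},X_0',\delta'_{\leftarrow_\epsilon})$, where $\varepsilon$ is an additional event with $\ell(\varepsilon)=\epsilon$, is obtained from $\mathrm{CC_A}(\mathcal{S})$ by adding transitions as follows: for all $y_1,y_2,y_3,y_4\in X$ and $t'\in T'$ such that $y_1\ne y_2$ and $((y_1,y_1),t',(y_3,y_4))\in\delta'$ (resp., $((y_2,y_2),t',(y_3,y_4))\in\delta'$), but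 $((y_1,y_2),\bar t',(y_3,y_4))\notin\delta'$ for any $\bar t'\in T'$, add the transition $((y_1,y_2),\varepsilon,(y_1,y_1))$ (resp., $((y_1,y_2),\varepsilon,(y_2,y_2))$). An observable transition sequence is one containing at least one event in $T_o'$; an unobservable one contains none.
   Formalization: In the ε-extended self-composition, the condition that (y1,y2) has no transition to (y3,y4) is imposed only for events with the same label as t', not for every event of T'; with the literal definition, items (i) and (ii) are false. *)

theory Defs
  imports Main
begin

record ('q, 'e) aut =
  states :: "'q set"
  events :: "'e set"
  init :: "'q set"
  transitions :: "('q \<times> 'e \<times> 'q) set"

(* The label None stands for the empty word epsilon. *)
record ('x, 't, 's) fsa = "('x, 't) aut" +
  outputs :: "'s set"
  label :: "'t \<Rightarrow> 's option"

definition is_fsa :: "('x, 't, 's) fsa \<Rightarrow> bool" where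
  "is_fsa S \<longleftrightarrow>
     finite (states S) \<and> finite (events S) \<and> finite (outputs S) \<and>
     init S \<subseteq> states S \<and>
     transitions S \<subseteq> states S \<times> events S \<times> states S \<and>
     (\<forall>t \<in> events S. label S t \<in> insert None (Some ` outputs S))"

definition label_seq :: "('e \<Rightarrow> 's option) \<Rightarrow> 'e list \<Rightarrow> 's list" where
  "label_seq l s = List.map_filter l s"

(* trans_seq D [x0, ..., xk] [t1, ..., tk] is the transition sequence
   x0 -t1-> x1 -t2-> ... -tk-> xk: under nondeterminism the visited states are not
   determined by the endpoints and the events. *)
inductive trans_seq :: "('q \<times> 'e \<times> 'q) set \<Rightarrow> 'q list \<Rightarrow> 'e list \<Rightarrow> bool"
  for D :: "('q \<times> 'e \<times> 'q) set" where
  Nil: "trans_seq D [x] []"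
| Cons: "(x, t, y) \<in> D \<Longrightarrow> trans_seq D (y # p) s \<Longrightarrow> trans_seq D (x # y # p) (t # s)"

definition reaches :: "('q \<times> 'e \<times> 'q) set \<Rightarrow> 'q \<Rightarrow> 'e list \<Rightarrow> 'q \<Rightarrow> bool" where
  "reaches D x s y \<longleftrightarrow> (\<exists>p. trans_seq D p s \<and> hd p = x \<and> last p = y)"

definition current_est :: "('x, 't, 's) fsa \<Rightarrow> 's list \<Rightarrow> 'x set" where
  "current_est S w =
     {x \<in> states S. \<exists>x0 \<in> init S. \<exists>s \<in> lists (events S).
        label_seq (label S) s = w \<and> reaches (transitions S) x0 s x}"

definition unobs_reach :: "('x, 't, 's) fsa \<Rightarrow> 'x set \<Rightarrow> 'x set" where
  "unobs_reach S A =
     (\<Union>x \<in> A. {x' \<in> states S.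
        \<exists>s \<in> lists {t \<in> events S. label S t = None}. reaches (transitions S) x s x'})"

definition obs_reach :: "('x, 't, 's) fsa \<Rightarrow> 's \<Rightarrow> 'x set \<Rightarrow> 'x set" where
  "obs_reach S \<sigma> A =
     (\<Union>x \<in> A. {x' \<in> states S.
        \<exists>t \<in> events S. (x, t, x') \<in> transitions S \<and> label S t = Some \<sigma>})"

(* The observer is specified by its behaviour from the initial state.  The empty set is not
   a state: where the current-state estimate is empty, no state is reached at all.
   Transitions out of states that are unreachable from the initial state are
   unconstrained. *)
definition is_observer :: "('x, 't, 's) fsa \<Rightarrow> ('x set, 's) aut \<Rightarrow> bool" where
  "is_observer S Ob \<longleftrightarrow>
     states Ob = Pow (states S) - {{}} \<and>
     events Ob = outputs S \<and>
     init Ob = {current_est S []} \<and>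
     transitions Ob \<subseteq> states Ob \<times> events Ob \<times> states Ob \<and>
     (\<forall>q \<sigma> q1 q2. (q, \<sigma>, q1) \<in> transitions Ob \<and> (q, \<sigma>, q2) \<in> transitions Ob \<longrightarrow> q1 = q2) \<and>
     (\<forall>w \<in> lists (outputs S). \<forall>X' \<in> states Ob.
        reaches (transitions Ob) (current_est S []) w X' \<longleftrightarrow> X' = current_est S w)"

definition detector_states :: "('x, 't, 's) fsa \<Rightarrow> 'x set set" where
  "detector_states S =
     ({current_est S []} \<union> {q. q \<subseteq> states S \<and> card q \<le> 2}) - {{}}"

definition detector :: "('x, 't, 's) fsa \<Rightarrow> ('x set, 's) aut" where
  "detector S = \<lparr>
     states = detector_states S,
     events = outputs S,
     init = {current_est S []},
     transitions = {(q, \<sigma>, q'). q \<in> detector_states S \<and> \<sigma> \<in> outputs S \<and> q' \<in> detector_states S \<and>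
       (let R = unobs_reach S (obs_reach S \<sigma> q) in
          card R > 1 \<and> q' \<subseteq> R \<and> card q' = 2 \<or>
          card R = 1 \<and> q' = R)}\<rparr>"

(* Events of the self-composition are pairs whose components are events of S or epsilon,
   the latter encoded as None. *)
type_synonym 't cc_event = "'t option \<times> 't option"

definition cc_obs_events :: "('x, 't, 's) fsa \<Rightarrow> 't cc_event set" where
  "cc_obs_events S =
     {(Some t, Some t') | t t'. t \<in> events S \<and> t' \<in> events S \<and>
        label S t = label S t' \<and> label S t \<noteq> None}"

definition cc_unobs_events :: "('x, 't, 's) fsa \<Rightarrow> 't cc_event set" where
  "cc_unobs_events S =
     {(Some t, None) | t. t \<in> events S \<and> label S t = None} \<union>
     {(None, Some t) | t. t \<in> events S \<and> label S t = None}"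

(* Both components of a composed event carry the same label, so the first one is used. *)
definition cc_label :: "('x, 't, 's) fsa \<Rightarrow> 't cc_event \<Rightarrow> 's option" where
  "cc_label S e = Option.bind (fst e) (label S)"

definition self_comp :: "('x, 't, 's) fsa \<Rightarrow> ('x \<times> 'x, 't cc_event) aut" where
  "self_comp S = \<lparr>
     states = states S \<times> states S,
     events = cc_obs_events S \<union> cc_unobs_events S,
     init = init S \<times> init S,
     transitions =
       {((y1, y1'), (Some t, Some t'), (y2, y2')) | y1 y1' t t' y2 y2'.
          (Some t, Some t') \<in> cc_obs_events S \<and> (y1, t, y2) \<in> transitions S \<and> (y1', t', y2') \<in> transitions S} \<union>
       {((y1, y1'), (Some t, None), (y2, y1')) | y1 y1' t y2.
          (Some t, None) \<in> cc_unobs_events S \<and> y1' \<in> states S \<and> (y1, t, y2) \<in> transitions S} \<union>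
       {((y1, y1'), (None, Some t), (y1, y2')) | y1 y1' t y2'.
          (None, Some t) \<in> cc_unobs_events S \<and> y1 \<in> states S \<and> (y1', t, y2') \<in> transitions S}\<rparr>"

(* The additional event; it is not an event of the self-composition and cc_label maps
   it to None. *)
definition eps_event :: "'t cc_event" where
  "eps_event = (None, None)"

(* (y1, y2) has no move to z that is labeled like the event e.
   The restriction to equally labeled events is a correction: if moves to z under arbitrary
   labels were considered, the epsilon-transitions needed to simulate the detector would be
   missing.  Take x1 -r-> x3, x2 -r-> x3, x1 -s-> x3 with different observable labels on r
   and s: the detector has a transition from {x1, x2} to {x3} labeled s, whereas (x1, x2)
   could only move under r. *)
definition no_matching_move ::
    "('x, 't, 's) fsa \<Rightarrow> 'x \<times> 'x \<Rightarrow> 't cc_event \<Rightarrow> 'x \<times> 'x \<Rightarrow> bool" where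
  "no_matching_move S y e z \<longleftrightarrow>
     (\<forall>e' \<in> events (self_comp S). cc_label S e' = cc_label S e \<longrightarrow>
        (y, e', z) \<notin> transitions (self_comp S))"

definition eps_self_comp :: "('x, 't, 's) fsa \<Rightarrow> ('x \<times> 'x, 't cc_event) aut" where
  "eps_self_comp S = \<lparr>
     states = states (self_comp S),
     events = events (self_comp S) \<union> {eps_event},
     init = init (self_comp S),
     transitions = transitions (self_comp S) \<union>
       {((y1, y2), eps_event, (y1, y1)) | y1 y2 y3 y4 e.
          y1 \<in> states S \<and> y2 \<in> states S \<and> y3 \<in> states S \<and> y4 \<in> states S \<and>
          e \<in> events (self_comp S) \<and> y1 \<noteq> y2 \<and>
          ((y1, y1), e, (y3, y4)) \<in> transitions (self_comp S) \<and>
          no_matching_move S (y1, y2) e (y3, y4)} \<union>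
       {((y1, y2), eps_event, (y2, y2)) | y1 y2 y3 y4 e.
          y1 \<in> states S \<and> y2 \<in> states S \<and> y3 \<in> states S \<and> y4 \<in> states S \<and>
          e \<in> events (self_comp S) \<and> y1 \<noteq> y2 \<and>
          ((y2, y2), e, (y3, y4)) \<in> transitions (self_comp S) \<and>
          no_matching_move S (y1, y2) e (y3, y4)}\<rparr>"

definition obs_connected ::
    "('x, 't, 's) fsa \<Rightarrow> 'x \<times> 'x \<Rightarrow> 's \<Rightarrow> 'x \<times> 'x \<Rightarrow> bool" where
  "obs_connected S y \<sigma> z \<longleftrightarrow>
     (\<exists>s \<in> lists (events (eps_self_comp S)).
        reaches (transitions (eps_self_comp S)) y s z \<and>
        set s \<inter> cc_obs_events S \<noteq> {} \<and>
        label_seq (cc_label S) s = [\<sigma>])"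

definition components :: "('x \<times> 'x) list \<Rightarrow> 'x set" where
  "components p = fst ` set p \<union> snd ` set p"

end

theory Submission
  imports Defs
begin

text \<open>A detector transition from \<open>{x\<^sub>1, x\<^sub>2}\<close> into \<open>{x\<^sub>3, x\<^sub>4}\<close> gives each target a source among
  \<open>x\<^sub>1, x\<^sub>2\<close>. If the sources differ, the self-composition moves along both at once. If they
  coincide, either the pair can move to the same intermediate pair under the same label, or the
  added \<open>\<epsilon>\<close>-transition first collapses the pair onto the common source.
  Conversely, every event of the extended self-composition, the \<open>\<epsilon>\<close>-event included, keeps both
  components inside the current-state estimate of the labels read so far, and these estimates
  are exactly the states along the observer's run.\<close>

section \<open>Runs of an automaton and their label words\<close>

lemma trans_seq_nonempty: "trans_seq D p s \<Longrightarrow> p \<noteq> []"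
  by (induction rule: trans_seq.induct) auto

text \<open>Sequences grow at the front by definition, whereas the observer's run is built by
  appending one observable step at a time.\<close>

lemma trans_seq_snoc:
  assumes "trans_seq D p s" and "(last p, t, y) \<in> D"
  shows "trans_seq D (p @ [y]) (s @ [t])"
  using assms by (induction rule: trans_seq.induct) (auto intro: trans_seq.intros)

lemma reaches_Nil: "reaches D x [] y \<longleftrightarrow> x = y"
proof
  assume "reaches D x [] y"
  then obtain p where "trans_seq D p []" "hd p = x" "last p = y"
    by (auto simp: reaches_def)
  then show "x = y"
    by (cases rule: trans_seq.cases) auto
next
  assume "x = y"
  then show "reaches D x [] y"
    unfolding reaches_def by (intro exI[of _ "[x]"]) (auto intro: trans_seq.Nil)
qed

text \<open>Together with \<open>reaches_Nil\<close> this is a recursion on the event word that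
  hides the list of visited states; later arguments about \<open>reaches\<close> rest on it.\<close>

lemma reaches_Cons: "reaches D x (t # s) y \<longleftrightarrow> (\<exists>z. (x, t, z) \<in> D \<and> reaches D z s y)"
proof
  assume "reaches D x (t # s) y"
  then obtain p where "trans_seq D p (t # s)" "hd p = x" "last p = y"
    by (auto simp: reaches_def)
  then show "\<exists>z. (x, t, z) \<in> D \<and> reaches D z s y"
    by (cases rule: trans_seq.cases) (fastforce simp: reaches_def)
next
  assume "\<exists>z. (x, t, z) \<in> D \<and> reaches D z s y"
  then obtain z p where z: "(x, t, z) \<in> D" and p: "trans_seq D p s" "hd p = z" "last p = y"
    by (auto simp: reaches_def)
  then obtain p' where "p = z # p'"
    using trans_seq_nonempty by (cases p) fastforce+
  with z p have "trans_seq D (x # p) (t # s)" "hd (x # p) = x" "last (x # p) = y"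
    by (auto intro: trans_seq.Cons)
  then show "reaches D x (t # s) y"
    unfolding reaches_def by blast
qed

lemma reaches_append: "reaches D x (s @ s') y \<longleftrightarrow> (\<exists>z. reaches D x s z \<and> reaches D z s' y)"
  by (induction s arbitrary: x) (auto simp: reaches_Nil reaches_Cons)

lemma label_seq_append: "label_seq l (s @ s') = label_seq l s @ label_seq l s'"
  by (simp add: label_seq_def map_filter_def)

lemma label_seq_single: "label_seq l [t] = (case l t of None \<Rightarrow> [] | Some \<sigma> \<Rightarrow> [\<sigma>])"
  by (simp add: label_seq_def map_filter_def split: option.split)

lemma label_seq_Cons: "label_seq l (t # s) = label_seq l [t] @ label_seq l s"
  using label_seq_append[of l "[t]" s] by simp

lemma label_seq_eq_Nil: "(\<And>t. t \<in> set s \<Longrightarrow> l t = None) \<Longrightarrow> label_seq l s = []"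
  by (induction s) (simp_all add: label_seq_def map_filter_def)

section \<open>Events and unobservable moves of the extended self-composition\<close>

lemma fsa_transitionD:
  assumes "is_fsa S" and "(x, t, y) \<in> transitions S"
  shows "x \<in> states S" "t \<in> events S" "y \<in> states S"
  using assms unfolding is_fsa_def by auto

lemma self_comp_subset_eps: "transitions (self_comp S) \<subseteq> transitions (eps_self_comp S)"
  by (auto simp: eps_self_comp_def)

lemma events_self_comp: "events (self_comp S) = cc_obs_events S \<union> cc_unobs_events S"
  by (simp add: self_comp_def)

lemma events_eps_self_comp:
  "events (eps_self_comp S) = cc_obs_events S \<union> cc_unobs_events S \<union> {eps_event}"
  by (simp add: eps_self_comp_def events_self_comp)

text \<open>The first component decides: it is either missing or an unobservable event of
  \<open>S\<close>.\<close>

lemma cc_unobs_event_label: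
  "e \<in> cc_unobs_events S \<union> {eps_event} \<Longrightarrow> cc_label S e = None"
  by (auto simp: cc_unobs_events_def cc_label_def eps_event_def)

text \<open>Each unobservable event lifts to a move of the left component alone. The idle component
  has to be a state because the one-sided transitions of \<open>self_comp\<close> demand it.\<close>

lemma eps_self_comp_left_unobs:
  assumes "s \<in> lists {t \<in> events S. label S t = None}"
    and "reaches (transitions S) x s y" and "z \<in> states S"
  shows "reaches (transitions (eps_self_comp S)) (x, z) (map (\<lambda>t. (Some t, None)) s) (y, z)"
  using assms
proof (induction s arbitrary: x rule: list.induct)
  case Nil
  then show ?case by (simp add: reaches_Nil)
next
  case (Cons t s)
  then obtain w where w: "(x, t, w) \<in> transitions S" "reaches (transitions S) w s y"
    by (auto simp: reaches_Cons)
  have t: "t \<in> events S" "label S t = None" "s \<in> lists {t \<in> events S. label S t = None}"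
    using Cons.prems(1) by (simp_all only: Cons_in_lists_iff mem_Collect_eq)
  then have "((x, z), (Some t, None), (w, z)) \<in> transitions (self_comp S)"
    using Cons.prems(3) w(1) by (simp add: self_comp_def cc_unobs_events_def)
  then have "((x, z), (Some t, None), (w, z)) \<in> transitions (eps_self_comp S)"
    using self_comp_subset_eps[of S] by blast
  then show ?case
    using Cons.IH[OF t(3) w(2) Cons.prems(3)] by (auto simp: reaches_Cons)
qed

lemma eps_self_comp_right_unobs:
  assumes "s \<in> lists {t \<in> events S. label S t = None}"
    and "reaches (transitions S) x s y" and "z \<in> states S"
  shows "reaches (transitions (eps_self_comp S)) (z, x) (map (\<lambda>t. (None, Some t)) s) (z, y)"
  using assms
proof (induction s arbitrary: x rule: list.induct)
  case Nil
  then show ?case by (simp add: reaches_Nil)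
next
  case (Cons t s)
  then obtain w where w: "(x, t, w) \<in> transitions S" "reaches (transitions S) w s y"
    by (auto simp: reaches_Cons)
  have t: "t \<in> events S" "label S t = None" "s \<in> lists {t \<in> events S. label S t = None}"
    using Cons.prems(1) by (simp_all only: Cons_in_lists_iff mem_Collect_eq)
  then have "((z, x), (None, Some t), (z, w)) \<in> transitions (self_comp S)"
    using Cons.prems(3) w(1) by (simp add: self_comp_def cc_unobs_events_def)
  then have "((z, x), (None, Some t), (z, w)) \<in> transitions (eps_self_comp S)"
    using self_comp_subset_eps[of S] by blast
  then show ?case
    using Cons.IH[OF t(3) w(2) Cons.prems(3)] by (auto simp: reaches_Cons)
qed

section \<open>Simulation of detector transitions\<close>

text \<open>The common shape of all simulating sequences: \<epsilon>-events, one observable event,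
  then the unobservable tails of both components. Only the observable event contributes a
  letter.\<close>

lemma obs_connectedI:
  assumes pre: "pre \<in> lists {eps_event}" "reaches (transitions (eps_self_comp S)) y pre y'"
    and e: "e \<in> cc_obs_events S" "cc_label S e = Some \<sigma>"
      "(y', e, (z3, z4)) \<in> transitions (self_comp S)"
    and z: "z4 \<in> states S"
    and u3: "u3 \<in> lists {t \<in> events S. label S t = None}" "reaches (transitions S) z3 u3 x3"
    and u4: "u4 \<in> lists {t \<in> events S. label S t = None}" "reaches (transitions S) z4 u4 x4"
    and x3: "x3 \<in> states S"
  shows "obs_connected S y \<sigma> (x3, x4)"
proof -
  let ?v = "map (\<lambda>t. (Some t, None)) u3 @ map (\<lambda>t. (None, Some t)) u4"
  let ?s = "pre @ e # ?v"
  \<comment> \<open>The left tail runs while the right component rests at \<open>z4\<close>; then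
    the right tail runs while the left one rests at \<open>x3\<close>.\<close>
  have "reaches (transitions (eps_self_comp S)) (z3, z4) ?v (x3, x4)"
    using eps_self_comp_left_unobs[OF u3 z] eps_self_comp_right_unobs[OF u4 x3]
    by (auto simp: reaches_append)
  then have r: "reaches (transitions (eps_self_comp S)) y ?s (x3, x4)"
    using pre(2) subsetD[OF self_comp_subset_eps e(3)]
    unfolding reaches_append[of _ _ pre] reaches_Cons by blast
  have v: "set ?v \<subseteq> cc_unobs_events S"
    using u3(1) u4(1) by (auto simp: cc_unobs_events_def)
  have "label_seq (cc_label S) pre = []"
    using pre(1) by (intro label_seq_eq_Nil) (auto simp: cc_unobs_event_label)
  moreover have "label_seq (cc_label S) ?v = []"
    using v cc_unobs_event_label by (intro label_seq_eq_Nil) blast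
  ultimately have "label_seq (cc_label S) ?s = [\<sigma>]"
    using e(2) by (simp only: label_seq_append label_seq_Cons[of _ e] label_seq_single) simp
  moreover have "?s \<in> lists (events (eps_self_comp S))"
    using pre(1) e(1) v unfolding in_lists_conv_set set_append list.set(2) events_eps_self_comp
    by blast
  ultimately show ?thesis
    unfolding obs_connected_def using r e(1) by (intro bexI[of _ ?s]) auto
qed

text \<open>The case of a common source \<open>a\<close>. The pair \<open>(a, a)\<close> can move to
  \<open>(z3, z4)\<close> under \<sigma>; it remains to start from \<open>(y1, y2)\<close>. The
  added \<epsilon>-transition exists exactly when \<open>(y1, y2)\<close> has no move of its own to
  \<open>(z3, z4)\<close> with that label, so one of the two ways is open.\<close>

lemma obs_connected_copy:
  assumes fsa: "is_fsa S"
    and y: "y1 \<in> states S" "y2 \<in> states S" and a: "a = y1 \<or> a = y2"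
    and t3: "t3 \<in> events S" "label S t3 = Some \<sigma>" "(a, t3, z3) \<in> transitions S"
    and t4: "t4 \<in> events S" "label S t4 = Some \<sigma>" "(a, t4, z4) \<in> transitions S"
    and u3: "u3 \<in> lists {t \<in> events S. label S t = None}" "reaches (transitions S) z3 u3 x3"
    and u4: "u4 \<in> lists {t \<in> events S. label S t = None}" "reaches (transitions S) z4 u4 x4"
    and x3: "x3 \<in> states S"
  shows "obs_connected S (y1, y2) \<sigma> (x3, x4)"
proof -
  let ?e = "(Some t3, Some t4)"
  have e: "?e \<in> cc_obs_events S" "cc_label S ?e = Some \<sigma>"
    using t3 t4 by (auto simp: cc_obs_events_def cc_label_def)
  have step: "((a, a), ?e, (z3, z4)) \<in> transitions (self_comp S)"
    using e t3 t4 by (auto simp: self_comp_def)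
  have z: "z3 \<in> states S" "z4 \<in> states S"
    using fsa_transitionD[OF fsa t3(3)] fsa_transitionD[OF fsa t4(3)] by auto
  show ?thesis
  proof (cases "y1 = y2")
    case True
    with a step show ?thesis
      by (intro obs_connectedI[OF _ _ e _ z(2) u3 u4 x3, where pre = "[]"])
        (auto simp: reaches_Nil)
  next
    case neq: False
    show ?thesis
    proof (cases "no_matching_move S (y1, y2) ?e (z3, z4)")
      case True
      \<comment> \<open>The pair collapses onto the left or the right component, according to which
        of them is the source.\<close>
      have "((y1, y2), eps_event, (a, a)) \<in> transitions (eps_self_comp S)"
        using a
      proof
        assume "a = y1"
        with True y z step e(1) neq show ?thesis
          unfolding eps_self_comp_def events_self_comp by (simp, blast)
      next
        assume "a = y2"
        with True y z step e(1) neq show ?thesis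
          unfolding eps_self_comp_def events_self_comp by (simp, blast)
      qed
      then show ?thesis
        by (intro obs_connectedI[OF _ _ e step z(2) u3 u4 x3, where pre = "[eps_event]"])
          (auto simp: reaches_Nil reaches_Cons)
    next
      case False
      \<comment> \<open>The matching move may use other events, but it ends in the same
        \<open>(z3, z4)\<close>, so the tails \<open>u3\<close> and \<open>u4\<close> still
        apply.\<close>
      then obtain e' where e': "e' \<in> events (self_comp S)" "cc_label S e' = Some \<sigma>"
        "((y1, y2), e', (z3, z4)) \<in> transitions (self_comp S)"
        using e(2) by (auto simp: no_matching_move_def)
      \<comment> \<open>An unobservable event would have label \<open>None\<close> instead of
        \<open>Some \<sigma>\<close>.\<close>
      then have "e' \<in> cc_obs_events S"
        using cc_unobs_event_label[of e' S] by (auto simp: events_self_comp)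
      then show ?thesis
        using e' by (intro obs_connectedI[OF _ _ _ _ _ z(2) u3 u4 x3, where pre = "[]"])
          (auto simp: reaches_Nil)
    qed
  qed
qed

text \<open>One source per component: both components move at once, and no \<epsilon>-event is
  involved.\<close>

lemma obs_connected_pair:
  assumes fsa: "is_fsa S"
    and t3: "t3 \<in> events S" "label S t3 = Some \<sigma>" "(y1, t3, z3) \<in> transitions S"
    and t4: "t4 \<in> events S" "label S t4 = Some \<sigma>" "(y2, t4, z4) \<in> transitions S"
    and u3: "u3 \<in> lists {t \<in> events S. label S t = None}" "reaches (transitions S) z3 u3 x3"
    and u4: "u4 \<in> lists {t \<in> events S. label S t = None}" "reaches (transitions S) z4 u4 x4"
    and x3: "x3 \<in> states S"
  shows "obs_connected S (y1, y2) \<sigma> (x3, x4)"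
proof -
  let ?e = "(Some t3, Some t4)"
  have e: "?e \<in> cc_obs_events S" "cc_label S ?e = Some \<sigma>"
    using t3 t4 by (auto simp: cc_obs_events_def cc_label_def)
  moreover have "((y1, y2), ?e, (z3, z4)) \<in> transitions (self_comp S)"
    using e t3 t4 by (auto simp: self_comp_def)
  ultimately show ?thesis
    using fsa_transitionD[OF fsa t4(3)]
    by (intro obs_connectedI[OF _ _ _ _ _ _ u3 u4 x3, where pre = "[]" and e = ?e])
      (auto simp: reaches_Nil)
qed

lemma unobs_reach_obs_reachE:
  assumes "x \<in> unobs_reach S (obs_reach S \<sigma> A)"
  obtains a t z u where "a \<in> A" "t \<in> events S" "label S t = Some \<sigma>" "(a, t, z) \<in> transitions S"
    "u \<in> lists {t \<in> events S. label S t = None}" "reaches (transitions S) z u x" "x \<in> states S"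
  using assms by (auto simp: unobs_reach_def obs_reach_def)

text \<open>Each target has a source in \<open>{y1, y2}\<close>, and the proof compares the two
  sources. The targets may coincide; then both alternatives agree, which covers detector transitions
  into singletons.\<close>

lemma obs_connected_reach:
  assumes fsa: "is_fsa S" and y: "y1 \<in> states S" "y2 \<in> states S"
    and x3: "x3 \<in> unobs_reach S (obs_reach S \<sigma> {y1, y2})"
    and x4: "x4 \<in> unobs_reach S (obs_reach S \<sigma> {y1, y2})"
  shows "obs_connected S (y1, y2) \<sigma> (x3, x4) \<or> obs_connected S (y1, y2) \<sigma> (x4, x3)"
proof -
  obtain a t3 z3 u3 where src3: "a \<in> {y1, y2}" "t3 \<in> events S" "label S t3 = Some \<sigma>"
    "(a, t3, z3) \<in> transitions S" "u3 \<in> lists {t \<in> events S. label S t = None}"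
    "reaches (transitions S) z3 u3 x3" "x3 \<in> states S"
    using x3 by (rule unobs_reach_obs_reachE)
  obtain b t4 z4 u4 where src4: "b \<in> {y1, y2}" "t4 \<in> events S" "label S t4 = Some \<sigma>"
    "(b, t4, z4) \<in> transitions S" "u4 \<in> lists {t \<in> events S. label S t = None}"
    "reaches (transitions S) z4 u4 x4" "x4 \<in> states S"
    using x4 by (rule unobs_reach_obs_reachE)
  consider "a = b" | "a = y1" "b = y2" | "a = y2" "b = y1"
    using src3(1) src4(1) by auto
  then show ?thesis
  proof cases
    case 1
    then show ?thesis
      using obs_connected_copy[OF fsa y _ src3(2-4) src4(2,3) _ src3(5,6) src4(5,6) src3(7)]
        src3(1) src4(4) by auto
  next
    case 2
    then show ?thesis
      using obs_connected_pair[OF fsa src3(2,3) _ src4(2,3) _ src3(5,6) src4(5,6) src3(7)]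
        src3(4) src4(4) by auto
  next
    \<comment> \<open>The sources are crossed, so moving both components at once produces the
      targets in exchanged order. This is why the conclusion is a disjunction.\<close>
    case 3
    then show ?thesis
      using obs_connected_pair[OF fsa src4(2,3) _ src3(2,3) _ src4(5,6) src3(5,6) src4(7)]
        src3(4) src4(4) by auto
  qed
qed

text \<open>With a single source no crossing can occur, so the targets are reached in the prescribed
  order.\<close>

lemma obs_connected_reach_diag:
  assumes fsa: "is_fsa S" and y: "y \<in> states S"
    and x3: "x3 \<in> unobs_reach S (obs_reach S \<sigma> {y})"
    and x4: "x4 \<in> unobs_reach S (obs_reach S \<sigma> {y})"
  shows "obs_connected S (y, y) \<sigma> (x3, x4)"
  using x3 x4
  by (elim unobs_reach_obs_reachE singletonE) (rule obs_connected_copy[OF fsa y y, of y]; simp)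

text \<open>Both clauses of the detector place the target inside this reach, which supplies a source
  and a path for each target state.\<close>

lemma detector_transition_subset:
  assumes "(q, \<sigma>, q') \<in> transitions (detector S)"
  shows "q' \<subseteq> unobs_reach S (obs_reach S \<sigma> q)"
  using assms by (auto simp: detector_def Let_def)

section \<open>Current-state estimates along the extended self-composition\<close>

lemma init_subset_current_est:
  assumes "is_fsa S"
  shows "init S \<subseteq> current_est S []"
proof
  fix x assume "x \<in> init S"
  then show "x \<in> current_est S []"
    using assms unfolding current_est_def is_fsa_def
    by (auto simp: label_seq_def map_filter_def reaches_Nil intro!: bexI[of _ x] bexI[of _ "[]"])
qed

text \<open>The label word of one event is empty or a single letter, so observable and unobservable
  steps are treated uniformly.\<close>

lemma current_est_step:
  assumes fsa: "is_fsa S" and x: "x \<in> current_est S w" and t: "(x, t, y) \<in> transitions S"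
  shows "y \<in> current_est S (w @ label_seq (label S) [t])"
proof -
  obtain x0 s where "x0 \<in> init S" "s \<in> lists (events S)" "label_seq (label S) s = w"
    "reaches (transitions S) x0 s x"
    using x by (auto simp: current_est_def)
  moreover from this have "reaches (transitions S) x0 (s @ [t]) y"
    using t by (auto simp: reaches_append reaches_Cons reaches_Nil)
  ultimately show ?thesis
    using fsa_transitionD[OF fsa t] unfolding current_est_def
    by (auto simp: label_seq_append intro!: bexI[of _ x0] bexI[of _ "s @ [t]"])
qed

text \<open>An observable event moves both components under one label. A one-sided event adds no
  letter, so the idle component stays in the estimate. The \<epsilon>-event adds no letter either
  and only copies a component that is already in it.\<close>

lemma eps_self_comp_step_current_est:
  assumes fsa: "is_fsa S" and y: "fst y \<in> current_est S w" "snd y \<in> current_est S w"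
    and step: "(y, e, z) \<in> transitions (eps_self_comp S)"
  shows "fst z \<in> current_est S (w @ label_seq (cc_label S) [e])"
    and "snd z \<in> current_est S (w @ label_seq (cc_label S) [e])"
proof -
  have "fst z \<in> current_est S (w @ label_seq (cc_label S) [e]) \<and>
    snd z \<in> current_est S (w @ label_seq (cc_label S) [e])"
    using step y current_est_step[OF fsa, of "fst y" w _ "fst z"]
      current_est_step[OF fsa, of "snd y" w _ "snd z"]
    unfolding eps_self_comp_def self_comp_def
    by (fastforce simp: cc_obs_events_def cc_unobs_events_def cc_label_def eps_event_def
        label_seq_single)
  then show "fst z \<in> current_est S (w @ label_seq (cc_label S) [e])"
    and "snd z \<in> current_est S (w @ label_seq (cc_label S) [e])" by auto
qed

text \<open>No letter is read, so the estimate stays fixed and contains every visited state, not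
  only those at the end.\<close>

lemma trans_seq_unobs_current_est:
  assumes fsa: "is_fsa S"
    and "trans_seq (transitions (eps_self_comp S)) p s"
    and "s \<in> lists (cc_unobs_events S \<union> {eps_event})"
    and "fst (hd p) \<in> current_est S w" "snd (hd p) \<in> current_est S w"
  shows "components p \<subseteq> current_est S w"
  using assms(2-)
proof (induction rule: trans_seq.induct)
  case (Nil x)
  then show ?case by (auto simp: components_def)
next
  case (Cons x t y p s)
  have "label_seq (cc_label S) [t] = []"
    using Cons.prems(1) by (intro label_seq_eq_Nil) (auto simp: cc_unobs_event_label)
  then have "fst y \<in> current_est S w" "snd y \<in> current_est S w"
    using eps_self_comp_step_current_est[OF fsa _ _ Cons.hyps(1), of w] Cons.prems by auto
  then have "components (y # p) \<subseteq> current_est S w"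
    using Cons.prems(1) by (intro Cons.IH) auto
  then show ?case
    using Cons.prems(2,3) by (simp add: components_def)
qed

section \<open>Runs of the observer\<close>

text \<open>The observer is specified only through its runs from the initial state. The transition
  is therefore cut off as the last step of the run on \<open>w @ [\<sigma>]\<close>, which exists
  because a nonempty estimate is a state.\<close>

lemma observer_transition:
  assumes obs: "is_observer S Ob" and w: "w \<in> lists (outputs S)" and \<sigma>: "\<sigma> \<in> outputs S"
    and ne: "current_est S (w @ [\<sigma>]) \<noteq> {}"
  shows "(current_est S w, \<sigma>, current_est S (w @ [\<sigma>])) \<in> transitions Ob"
proof -
  have obs_states: "states Ob = Pow (states S) - {{}}"
    and obs_transitions: "transitions Ob \<subseteq> states Ob \<times> events Ob \<times> states Ob"
    and beh: "\<forall>w \<in> lists (outputs S). \<forall>X' \<in> states Ob.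
      reaches (transitions Ob) (current_est S []) w X' \<longleftrightarrow> X' = current_est S w"
    using obs unfolding is_observer_def by - (elim conjE, assumption)+
  have "current_est S (w @ [\<sigma>]) \<in> states Ob"
    using ne by (auto simp: obs_states current_est_def)
  then have "reaches (transitions Ob) (current_est S []) (w @ [\<sigma>]) (current_est S (w @ [\<sigma>]))"
    using beh w \<sigma> by simp
  then obtain X where X: "reaches (transitions Ob) (current_est S []) w X"
    "(X, \<sigma>, current_est S (w @ [\<sigma>])) \<in> transitions Ob"
    by (auto simp: reaches_append reaches_Cons reaches_Nil)
  \<comment> \<open>The specification speaks of states only, so this is needed before it can
    identify \<open>X\<close> with the estimate for \<open>w\<close>.\<close>
  then have "X \<in> states Ob"
    using obs_transitions by blast
  then have "X = current_est S w"
    using X(1) beh w by simp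
  then show ?thesis
    using X(2) by simp
qed

text \<open>The estimate after the first \<open>i\<close> observable labels serves as
  \<open>qbar i\<close>. The inclusion is proved first, since it yields the nonempty estimates that
  the observer's transitions require.\<close>

lemma observer_run:
  assumes fsa: "is_fsa S" and obs: "is_observer S Ob"
    and start: "x' 0 \<in> init (eps_self_comp S)"
    and unobs: "\<And>i. i \<le> n \<Longrightarrow> s' i \<in> lists (cc_unobs_events S \<union> {eps_event}) \<and>
      trans_seq (transitions (eps_self_comp S)) (p i) (s' i) \<and>
      hd (p i) = x' (2 * i) \<and> last (p i) = x' (2 * i + 1)"
    and step: "\<And>i. i \<in> {1..n} \<Longrightarrow> t' i \<in> cc_obs_events S \<and>
      (x' (2 * i - 1), t' i, x' (2 * i)) \<in> transitions (eps_self_comp S)"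
  defines "qbar \<equiv> \<lambda>i. current_est S (label_seq (cc_label S) (map t' [1..<Suc i]))"
  shows "\<And>i. i \<le> n \<Longrightarrow> components (p i) \<subseteq> qbar i"
    and "trans_seq (transitions Ob) (map qbar [0..<Suc n])
      (label_seq (cc_label S) (map t' [1..<Suc n]))"
proof -
  define w where "w i = label_seq (cc_label S) (map t' [1..<Suc i])" for i
  have qbar: "qbar i = current_est S (w i)" for i
    by (simp add: qbar_def w_def)
  have w_Suc: "w (Suc i) = w i @ label_seq (cc_label S) [t' (Suc i)]" for i
    by (simp add: w_def label_seq_append)
  have comp: "components (p i) \<subseteq> qbar i" if "i \<le> n" for i
    using that
  proof (induction i)
    case 0
    have "fst (hd (p 0)) \<in> init S" "snd (hd (p 0)) \<in> init S"
      using start unobs[of 0] by (auto simp: eps_self_comp_def self_comp_def)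
    then show ?case
      using init_subset_current_est[OF fsa] unobs[of 0]
      by (intro trans_seq_unobs_current_est[OF fsa, THEN subset_trans])
        (auto simp: qbar_def label_seq_def map_filter_def)
  next
    case (Suc i)
    have ne: "p i \<noteq> []" and l: "last (p i) = x' (2 * i + 1)"
      using unobs[of i] Suc.prems trans_seq_nonempty by fastforce+
    \<comment> \<open>The last pair of block \<open>i\<close> is where \<open>t' (Suc i)\<close>
      starts; the induction hypothesis puts its components into the estimate.\<close>
    have "last (p i) \<in> set (p i)"
      using ne by simp
    then have "fst (last (p i)) \<in> components (p i)" "snd (last (p i)) \<in> components (p i)"
      unfolding components_def by blast+
    then have in_est: "fst (x' (2 * i + 1)) \<in> current_est S (w i)"
      "snd (x' (2 * i + 1)) \<in> current_est S (w i)"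
      using Suc l by (auto simp: qbar)
    \<comment> \<open>The index \<open>2 * Suc i - 1\<close> is \<open>2 * i + 1\<close>.\<close>
    have tr: "(x' (2 * i + 1), t' (Suc i), x' (2 * Suc i)) \<in> transitions (eps_self_comp S)"
      using step[of "Suc i"] Suc.prems by auto
    have "fst (hd (p (Suc i))) \<in> current_est S (w (Suc i))"
      "snd (hd (p (Suc i))) \<in> current_est S (w (Suc i))"
      using eps_self_comp_step_current_est[OF fsa in_est tr] unobs[OF Suc.prems]
      by (simp_all add: w_Suc)
    then show ?case
      using trans_seq_unobs_current_est[OF fsa, of "p (Suc i)" "s' (Suc i)"] unobs[OF Suc.prems]
      unfolding qbar by simp
  qed
  \<comment> \<open>Every observable event yields exactly one letter, so observable events and steps
    of the observer correspond one to one.\<close>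
  have outs: "\<exists>\<sigma> \<in> outputs S. label_seq (cc_label S) [t' i] = [\<sigma>]" if i: "i \<in> {1..n}" for i
  proof -
    obtain t u \<sigma> where t: "t' i = (Some t, Some u)" "t \<in> events S" "label S t = Some \<sigma>"
      using step[OF i] by (auto simp: cc_obs_events_def)
    then have "\<sigma> \<in> outputs S"
      using fsa by (fastforce simp: is_fsa_def)
    with t show ?thesis
      by (auto simp: label_seq_single cc_label_def)
  qed
  \<comment> \<open>Membership in the output words is carried along because the specification of the
    observer covers only such words.\<close>
  have "w i \<in> lists (outputs S) \<and> trans_seq (transitions Ob) (map qbar [0..<Suc i]) (w i)"
    if "i \<le> n" for i
    using that
  proof (induction i)
    case 0
    then show ?case
      by (auto simp: w_def label_seq_def map_filter_def intro: trans_seq.Nil)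
  next
    case (Suc i)
    obtain \<sigma> where \<sigma>: "\<sigma> \<in> outputs S" "label_seq (cc_label S) [t' (Suc i)] = [\<sigma>]"
      using outs[of "Suc i"] Suc.prems by auto
    \<comment> \<open>The pairs visited in the next block witness that the next estimate is
      nonempty.\<close>
    have "p (Suc i) \<noteq> []"
      using unobs[OF Suc.prems] trans_seq_nonempty by blast
    then have "components (p (Suc i)) \<noteq> {}"
      by (auto simp: components_def)
    then have "current_est S (w i @ [\<sigma>]) \<noteq> {}"
      using comp[OF Suc.prems] \<sigma> by (auto simp: qbar w_Suc)
    then have "(qbar i, \<sigma>, qbar (Suc i)) \<in> transitions Ob"
      using observer_transition[OF obs _ \<sigma>(1), of "w i"] Suc \<sigma>(2) by (simp add: qbar w_Suc)
    then have "trans_seq (transitions Ob) (map qbar [0..<Suc i] @ [qbar (Suc i)]) (w i @ [\<sigma>])"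
      using Suc by (intro trans_seq_snoc) auto
    then show ?case
      using Suc \<sigma> by (simp add: w_Suc)
  qed
  then show "trans_seq (transitions Ob) (map qbar [0..<Suc n])
      (label_seq (cc_label S) (map t' [1..<Suc n]))"
    by (simp add: w_def)
  show "\<And>i. i \<le> n \<Longrightarrow> components (p i) \<subseteq> qbar i"
    by (rule comp)
qed

section \<open>Detector and observer claims combined\<close>

theorem proposition4p9:
  fixes S :: "('x, 't, 's) fsa" and Ob :: "('x set, 's) aut"
  assumes "is_fsa S" and "is_observer S Ob"
  shows
    "(\<forall>x1 \<in> states S. \<forall>x2 \<in> states S. \<forall>x3 \<in> states S. \<forall>x4 \<in> states S.
       x1 \<noteq> x2 \<and> x3 \<noteq> x4 \<longrightarrow>
       (\<forall>\<sigma> \<in> outputs S.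
          (({x1, x2}, \<sigma>, {x3, x4}) \<in> transitions (detector S) \<longrightarrow>
             obs_connected S (x1, x2) \<sigma> (x3, x4) \<or> obs_connected S (x1, x2) \<sigma> (x4, x3)) \<and>
          (({x1, x2}, \<sigma>, {x3}) \<in> transitions (detector S) \<longrightarrow>
             obs_connected S (x1, x2) \<sigma> (x3, x3)) \<and>
          (({x1}, \<sigma>, {x3, x4}) \<in> transitions (detector S) \<longrightarrow>
             obs_connected S (x1, x1) \<sigma> (x3, x4)) \<and>
          (({x1}, \<sigma>, {x3}) \<in> transitions (detector S) \<longrightarrow>
             obs_connected S (x1, x1) \<sigma> (x3, x3)))) \<and>
     (\<forall>(n :: nat) (x' :: nat \<Rightarrow> 'x \<times> 'x) (s' :: nat \<Rightarrow> 't cc_event list)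
        (p :: nat \<Rightarrow> ('x \<times> 'x) list) (t' :: nat \<Rightarrow> 't cc_event).
       x' 0 \<in> init (eps_self_comp S) \<and>
       (\<forall>j \<in> {1..2 * n + 1}. x' j \<in> states (eps_self_comp S)) \<and>
       (\<forall>i \<le> n. s' i \<in> lists (cc_unobs_events S \<union> {eps_event}) \<and>
          trans_seq (transitions (eps_self_comp S)) (p i) (s' i) \<and>
          hd (p i) = x' (2 * i) \<and> last (p i) = x' (2 * i + 1)) \<and>
       (\<forall>i \<in> {1..n}. t' i \<in> cc_obs_events S \<and>
          (x' (2 * i - 1), t' i, x' (2 * i)) \<in> transitions (eps_self_comp S)) \<longrightarrow>
       (\<exists>qbar :: nat \<Rightarrow> 'x set.
          qbar 0 = current_est S [] \<and>
          (\<forall>i \<in> {1..n}. components (p i) \<subseteq> qbar i) \<and>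
          trans_seq (transitions Ob) (map qbar [0..<Suc n])
            (label_seq (cc_label S) (map t' [1..<Suc n]))))" (is "?detector \<and> ?observer")
proof (intro conjI)
  \<comment> \<open>Sources with two names use the disjunctive lemma, taken with equal targets for
    \<open>{x3}\<close>; singleton sources use the diagonal one.\<close>
  have "({x1, x2}, \<sigma>, {x3, x4}) \<in> transitions (detector S) \<longrightarrow>
      obs_connected S (x1, x2) \<sigma> (x3, x4) \<or> obs_connected S (x1, x2) \<sigma> (x4, x3)"
    "({x1, x2}, \<sigma>, {x3}) \<in> transitions (detector S) \<longrightarrow> obs_connected S (x1, x2) \<sigma> (x3, x3)"
    "({x1}, \<sigma>, {x3, x4}) \<in> transitions (detector S) \<longrightarrow> obs_connected S (x1, x1) \<sigma> (x3, x4)"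
    "({x1}, \<sigma>, {x3}) \<in> transitions (detector S) \<longrightarrow> obs_connected S (x1, x1) \<sigma> (x3, x3)"
    if "x1 \<in> states S" "x2 \<in> states S" for x1 x2 x3 x4 \<sigma>
    using obs_connected_reach[OF assms(1) that, of _ \<sigma>]
      obs_connected_reach_diag[OF assms(1) that(1), of _ \<sigma>]
      detector_transition_subset[of "{x1, x2}" \<sigma> _ S] detector_transition_subset[of "{x1}" \<sigma> _ S]
    by (meson insert_subset)+
  then show ?detector by (intro ballI impI conjI; simp)
next
  show ?observer
  proof (intro allI impI, elim conjE)
    fix n :: nat and x' s' p t'
    \<comment> \<open>At \<open>i = 0\<close> the interval \<open>[1..<Suc i]\<close> is empty, so
      the sequence starts in the observer's initial state.\<close>
    let ?qbar = "\<lambda>i. current_est S (label_seq (cc_label S) (map t' [1..<Suc i]))"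
    assume start: "x' 0 \<in> init (eps_self_comp S)"
      and unobs: "\<forall>i \<le> n. s' i \<in> lists (cc_unobs_events S \<union> {eps_event}) \<and>
          trans_seq (transitions (eps_self_comp S)) (p i) (s' i) \<and>
          hd (p i) = x' (2 * i) \<and> last (p i) = x' (2 * i + 1)"
      and step: "\<forall>i \<in> {1..n}. t' i \<in> cc_obs_events S \<and>
          (x' (2 * i - 1), t' i, x' (2 * i)) \<in> transitions (eps_self_comp S)"
    have "i \<le> n \<Longrightarrow> components (p i) \<subseteq> ?qbar i" for i
      using unobs step by (intro observer_run(1)[OF assms, of x' n s' p t'] start) simp_all
    moreover have "trans_seq (transitions Ob) (map ?qbar [0..<Suc n])
        (label_seq (cc_label S) (map t' [1..<Suc n]))"
      using unobs step by (intro observer_run(2)[OF assms, of x' n s' p t'] start) simp_all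
    ultimately show "\<exists>qbar. qbar 0 = current_est S [] \<and> (\<forall>i \<in> {1..n}. components (p i) \<subseteq> qbar i) \<and>
        trans_seq (transitions Ob) (map qbar [0..<Suc n])
          (label_seq (cc_label S) (map t' [1..<Suc n]))"
      by (intro exI[of _ ?qbar]) (simp add: label_seq_def map_filter_def del: upt_Suc)
  qed
qed

end
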